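(* Let $S=\{l,m\}$ with $2\le l<m$ be admissible (i.e. $m\ge l+2$). In the expansion $p(S;n)=\sum_{k\ge0}C^S_k\binom{n-m}{k}$ we have $C^S_0=0$, and for $k\ge1$ $$C^S_k=-2\binom{m-1}{k+m-l}\chi(m-l\text{ even})+\sum_{j=0}^{m-l-2}(-1)^j\left[\binom{m-j-2}{l-1}-1\right]\binom{m}{k+j+1}.$$ Furthermore, $C^S_k\ge0$ for $k\ge (m-2)/2$.
   Context: For a permutation $\pi=a_1\ldots a_n$ of $\{1,\ldots,n\}$, an index $i$ is a peak if $a_{i-1}<a_i>a_{i+1}$. $P(S;n)$ is the set of permutations of $\{1,\dots,n\}$ whose set of peaks is exactly $S$. For an admissible finite set $S$, the peak polynomial $p(S;n)$ is the unique polynomial with $\#P(S;n)=p(S;n)2^{n-\#S-1}$ for all $n>\max S$. The coefficients $C^S_k$ are defined by $p(S;n)=\sum_{k\ge0}C^S_k\binom{n-m}{k}$ where $m=\max S$. $\chi(\text{statement})$ is $1$ if the statement is true and $0$ otherwise. Convention: $\binom{a}{b}=0$ if $b<0$ or $b>a$. *)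

theory Defs
  imports
    Complex_Main
    "HOL-Combinatorics.Permutations"
    "HOL-Computational_Algebra.Polynomial"
begin

text \<open>A permutation \<open>a\<^sub>1 \<dots> a\<^sub>n\<close> of \<open>{1..n}\<close> is a function \<open>\<pi>\<close> with \<open>\<pi> i = a\<^sub>i\<close>.
  Both neighbours of a peak must exist, so a peak lies strictly between \<open>1\<close> and \<open>n\<close>.\<close>

definition peaks :: "nat \<Rightarrow> (nat \<Rightarrow> nat) \<Rightarrow> nat set" where
  "peaks n \<pi> = {i. 1 < i \<and> i < n \<and> \<pi> (i - 1) < \<pi> i \<and> \<pi> i > \<pi> (i + 1)}"

definition peak_perms :: "nat set \<Rightarrow> nat \<Rightarrow> (nat \<Rightarrow> nat) set" where
  "peak_perms S n = {\<pi>. \<pi> permutes {1..n} \<and> peaks n \<pi> = S}"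

definition admissible :: "nat set \<Rightarrow> bool" where
  "admissible S \<longleftrightarrow> (\<exists>n. peak_perms S n \<noteq> {})"

text \<open>The maximum of a finite set of positions, with the convention that the empty set
  has maximum \<open>0\<close>.\<close>

definition max_pos :: "nat set \<Rightarrow> nat" where
  "max_pos S = Max (insert 0 S)"

text \<open>The truncated subtraction in the exponent is harmless: if \<open>S\<close> is admissible then
  \<open>n > max S\<close> implies \<open>n \<ge> #S + 1\<close>.\<close>

definition peak_poly :: "nat set \<Rightarrow> real poly" where
  "peak_poly S = (THE p. \<forall>n > max_pos S.
     real (card (peak_perms S n)) = poly p (real n) * 2 ^ (n - card S - 1))"

text \<open>Coefficients of the peak polynomial in the basis \<open>binom (x - max S) k\<close> of the
  space of polynomials in \<open>x\<close>; the generalised binomial coefficient is a polynomial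
  in its upper argument.\<close>

definition peak_coeff :: "nat set \<Rightarrow> nat \<Rightarrow> real" where
  "peak_coeff S = (THE C. finite {k. C k \<noteq> 0} \<and>
     (\<forall>x. poly (peak_poly S) x
            = (\<Sum>k | C k \<noteq> 0. C k * ((x - real (max_pos S)) gchoose k))))"

lemma admissible_doubleton_iff:
  assumes "2 \<le> l" "l < m"
  shows "admissible {l, m} \<longleftrightarrow> l + 2 \<le> m"
proof
  assume "admissible {l, m}"
  then obtain n \<pi> where "peaks n \<pi> = {l, m}"
    by (auto simp: admissible_def peak_perms_def)
  then have "l \<in> peaks n \<pi>" "m \<in> peaks n \<pi>" by auto
  then have "m \<noteq> l + 1" by (auto simp: peaks_def)
  with assms show "l + 2 \<le> m" by simp
next
  assume lm: "l + 2 \<le> m"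
  define \<pi> where "\<pi> = transpose l (l + 1) \<circ> transpose m (m + 1)"
  have "\<pi> permutes {1..m + 1}"
    unfolding \<pi>_def using assms lm
    by (intro permutes_compose permutes_swap_id) auto
  moreover have \<pi>: "\<pi> i = (if i = l then l + 1 else if i = l + 1 then l
      else if i = m then m + 1 else if i = m + 1 then m else i)" for i
    using assms lm by (auto simp: \<pi>_def transpose_def)
  have "i \<in> peaks (m + 1) \<pi> \<longleftrightarrow> i \<in> {l, m}" for i
  proof -
    consider "i < l" | "i = l" | "i = l + 1" | "l + 1 < i" "i < m" | "i = m" | "m < i"
      by linarith
    then show ?thesis
      by cases (insert assms lm, simp_all add: peaks_def \<pi>, linarith+)
  qed
  then have "peaks (m + 1) \<pi> = {l, m}" by (intro set_eqI)
  ultimately show "admissible {l, m}"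
    unfolding admissible_def peak_perms_def by blast
qed

end

theory Submission
  imports Defs "HOL-Combinatorics.Multiset_Permutations"
begin

text \<open>Choosing which letters come first and cutting after position \<open>m - 1\<close> gives
  \<open>binom n (m - 1) * #P(S; m - 1) * #P({}; n - m + 1) = #P(S; n) + #P(S \<union> {m - 1}; n) + #P(S \<union> {m}; n)\<close>
  for \<open>S \<subseteq> {..< m - 1}\<close> and \<open>n \<ge> m\<close>. From \<open>#P({}; n) = 2 ^ (n - 1)\<close> this recursion
  yields \<open>p({l}; n)\<close>, then \<open>p({l, m}; n)\<close> as an alternating sum of binomial coefficients,
  which Vandermonde's identity expands in the basis \<open>binom (n - m) k\<close>.
  For \<open>k \<ge> (m - 2) / 2\<close> the terms of the resulting alternating sum decrease in absolute value,
  and if their number is odd the last one dominates the correction term.\<close>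

section \<open>Peaks of lists\<close>

text \<open>Positions count from 1 and list entries from 0, so position \<open>i\<close> holds
  \<open>xs ! (i - 1)\<close>. Arbitrary linearly ordered letters are allowed because the two pieces
  of a cut permutation are words over subsets of \<open>{1..n}\<close>.\<close>

definition list_peaks :: "'a::linorder list \<Rightarrow> nat set" where
  "list_peaks xs = {i. 1 < i \<and> i < length xs \<and> xs ! (i - 2) < xs ! (i - 1) \<and> xs ! i < xs ! (i - 1)}"

definition peak_lists :: "nat set \<Rightarrow> 'a::linorder set \<Rightarrow> 'a list set" where
  "peak_lists S A = {xs \<in> permutations_of_set A. list_peaks xs = S}"

definition peak_number :: "nat set \<Rightarrow> nat \<Rightarrow> nat" where
  "peak_number S n = card (peak_lists S {1..n})"

lemma finite_peak_lists [simp]: "finite A \<Longrightarrow> finite (peak_lists S A)"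
  by (simp add: peak_lists_def)

lemma peak_lists_length: "xs \<in> peak_lists S A \<Longrightarrow> length xs = card A"
  by (auto simp: peak_lists_def permutations_of_set_def distinct_card)

text \<open>A permutation fixes everything outside \<open>{1..n}\<close>, so its word determines it.
  Surjectivity then follows by counting, since both sides have n! elements.\<close>

lemma bij_betw_permutes_lists:
  "bij_betw (\<lambda>\<pi>. map \<pi> [1..<Suc n]) {\<pi>. \<pi> permutes {1..n}} (permutations_of_set {1..n})"
proof -
  let ?f = "\<lambda>\<pi>::nat \<Rightarrow> nat. map \<pi> [1..<Suc n]" and ?P = "{\<pi>. \<pi> permutes {1..n}}"
  have inj: "inj_on ?f ?P"
  proof (rule inj_onI)
    fix \<pi> \<sigma> :: "nat \<Rightarrow> nat"
    assume *: "\<pi> \<in> ?P" "\<sigma> \<in> ?P" "?f \<pi> = ?f \<sigma>"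
    then have "\<pi> i = \<sigma> i" if "i \<in> {1..n}" for i
      using that by (auto simp: map_eq_conv simp del: upt_Suc)
    moreover have "\<pi> i = \<sigma> i" if "i \<notin> {1..n}" for i
      using * that by (simp add: permutes_not_in)
    ultimately show "\<pi> = \<sigma>" by blast
  qed
  have "?f ` ?P \<subseteq> permutations_of_set {1..n}"
  proof
    fix xs assume "xs \<in> ?f ` ?P"
    then obtain \<pi> where \<pi>: "\<pi> permutes {1..n}" "xs = ?f \<pi>" by auto
    have eq: "set [1..<Suc n] = {1..n}" by auto
    have "\<pi> ` {1..n} = {1..n}" using \<pi>(1) by (rule permutes_image)
    moreover have "inj_on \<pi> {1..n}" using \<pi>(1) by (rule permutes_inj_on)
    ultimately show "xs \<in> permutations_of_set {1..n}"
      unfolding \<pi>(2) permutations_of_set_def mem_Collect_eq distinct_map set_map eq by simp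
  qed
  moreover have "card (?f ` ?P) = card (permutations_of_set {1..n})"
    using inj by (simp add: card_image card_permutations)
  ultimately show ?thesis
    using inj by (simp add: bij_betw_def card_subset_eq)
qed

lemma card_peak_perms: "card (peak_perms S n) = peak_number S n"
proof -
  let ?f = "\<lambda>\<pi>::nat \<Rightarrow> nat. map \<pi> [1..<Suc n]"
  have "peaks n \<pi> = list_peaks (?f \<pi>)" for \<pi>
    by (auto simp: peaks_def list_peaks_def nth_append numeral_2_eq_2 Suc_diff_Suc simp del: upt_Suc)
  then have "bij_betw ?f (peak_perms S n) (peak_lists S {1..n})"
    using bij_betw_permutes_lists[of n]
    unfolding bij_betw_def peak_perms_def peak_lists_def
    by (auto simp: inj_on_def simp del: upt_Suc)
  then show ?thesis
    unfolding peak_number_def by (rule bij_betw_same_card)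
qed

lemma list_peaks_map:
  assumes "strict_mono_on (set xs) h"
  shows "list_peaks (map h xs) = list_peaks xs"
proof -
  have "h x < h y \<longleftrightarrow> x < y" if "x \<in> set xs" "y \<in> set xs" for x y
    using assms that by (simp add: strict_mono_on_less)
  then show ?thesis by (auto simp: list_peaks_def)
qed

text \<open>Standardisation: relabelling along the increasing bijection preserves all comparisons of
  letters, hence the peaks.\<close>

lemma card_peak_lists_lessThan:
  fixes A :: "nat set"
  assumes "finite A"
  shows "card (peak_lists S {..<card A}) = card (peak_lists S A)"
proof -
  obtain h :: "nat \<Rightarrow> nat" where h: "bij_betw h {..<card A} A" "strict_mono_on {..<card A} h"
    using ex_bij_betw_strict_mono_card[OF assms] by blast
  have hA: "h ` {..<card A} = A" and inj: "inj_on h {..<card A}"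
    using h(1) by (auto simp: bij_betw_def)
  have "inj_on (map h) (peak_lists S {..<card A})"
    by (rule inj_on_subset[OF inj_on_mapI[of h "permutations_of_set {..<card A}"]])
       (use inj in \<open>auto simp: peak_lists_def permutations_of_set_def intro: inj_on_subset\<close>)
  moreover have "map h ` peak_lists S {..<card A} = peak_lists S A"
  proof -
    have "permutations_of_set A = map h ` permutations_of_set {..<card A}"
      using permutations_of_set_image_inj[OF inj] hA by simp
    moreover have "list_peaks (map h xs) = list_peaks xs"
      if "xs \<in> permutations_of_set {..<card A}" for xs
      using list_peaks_map[of xs h] h(2) that by (simp add: permutations_of_set_def)
    ultimately show ?thesis by (auto simp: peak_lists_def)
  qed
  ultimately show ?thesis by (metis card_image)
qed

lemma card_peak_lists:
  fixes A :: "nat set"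
  assumes "finite A"
  shows "card (peak_lists S A) = peak_number S (card A)"
  using card_peak_lists_lessThan[OF assms, of S] card_peak_lists_lessThan[of "{1..card A}" S]
  by (simp add: peak_number_def)

lemma list_peaks_take: "list_peaks (take k xs) = {i \<in> list_peaks xs. i < k}"
  by (auto simp: list_peaks_def)

text \<open>Position \<open>k + 1\<close> of \<open>xs\<close> becomes first and loses its left
  neighbour; this is why \<open>1 < i\<close> is required.\<close>

lemma list_peaks_drop:
  "list_peaks (drop k xs) = {i. 1 < i \<and> k + i \<in> list_peaks xs}"
  by (auto simp: list_peaks_def)

lemma list_peaks_gt: "i \<in> list_peaks xs \<Longrightarrow> 1 < i \<and> i < length xs"
  by (simp add: list_peaks_def)

lemma list_peaks_not_consecutive: "i \<in> list_peaks xs \<Longrightarrow> Suc i \<notin> list_peaks xs"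
  by (auto simp: list_peaks_def numeral_2_eq_2)

section \<open>Counting permutations by their peaks\<close>

text \<open>Cut a word after position \<open>k\<close>. The two pieces see every peak except those at \<open>k\<close> and
  \<open>k + 1\<close>, and at most one of these two positions is a peak.\<close>

lemma peak_number_split:
  assumes "1 \<le> k" "k < n" "S \<subseteq> {..<k}"
  shows "(n choose k) * peak_number S k * peak_number {} (n - k)
    = peak_number S n + peak_number (insert k S) n + peak_number (insert (Suc k) S) n"
proof -
  define X where "X = {xs \<in> permutations_of_set {1..n}.
    list_peaks (take k xs) = S \<and> list_peaks (drop k xs) = {}}"
  have iff: "list_peaks (take k xs) = S \<and> list_peaks (drop k xs) = {} \<longleftrightarrow>
    list_peaks xs = S \<or> list_peaks xs = insert k S \<or> list_peaks xs = insert (Suc k) S" for xs :: "nat list"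
  proof
    assume L: "list_peaks (take k xs) = S \<and> list_peaks (drop k xs) = {}"
    have upper: "i \<le> Suc k" if "i \<in> list_peaks xs" for i
    proof (rule ccontr)
      assume "\<not> i \<le> Suc k"
      then have "i - k \<in> list_peaks (drop k xs)"
        using that by (simp add: list_peaks_drop)
      then show False using L by simp
    qed
    have "i \<in> list_peaks xs \<longleftrightarrow> i \<in> S \<or> i \<in> list_peaks xs \<and> (i = k \<or> i = Suc k)" for i
      using L upper[of i] unfolding list_peaks_take by (cases "i < k") force+
    with list_peaks_not_consecutive[of k xs]
    show "list_peaks xs = S \<or> list_peaks xs = insert k S \<or> list_peaks xs = insert (Suc k) S"
      by blast
  next
    assume "list_peaks xs = S \<or> list_peaks xs = insert k S \<or> list_peaks xs = insert (Suc k) S"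
    then show "list_peaks (take k xs) = S \<and> list_peaks (drop k xs) = {}"
      using assms(3) unfolding list_peaks_take list_peaks_drop by fastforce
  qed
  have X_Un: "X = peak_lists S {1..n} \<union> (peak_lists (insert k S) {1..n} \<union> peak_lists (insert (Suc k) S) {1..n})"
    unfolding X_def iff by (auto simp: peak_lists_def)
  have neq: "insert k S \<noteq> S" "insert (Suc k) S \<noteq> S" "insert k S \<noteq> insert (Suc k) S"
    using assms(3) by auto
  have "card X = peak_number S n + (peak_number (insert k S) n + peak_number (insert (Suc k) S) n)"
    unfolding X_Un peak_number_def
    using neq by (simp add: card_Un_disjoint disjoint_iff peak_lists_def)
  moreover have "card X = (n choose k) * peak_number S k * peak_number {} (n - k)"
  proof -
    \<comment> \<open>A word of \<open>X\<close> corresponds to the set \<open>A\<close> of its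
      first \<open>k\<close> letters together with its two pieces; concatenation inverts
      this.\<close>
    define T where "T = (SIGMA A:{A. A \<subseteq> {1..n} \<and> card A = k}. peak_lists S A \<times> peak_lists {} ({1..n} - A))"
    define f where "f = (\<lambda>(A :: nat set, ys :: nat list, zs). ys @ zs)"
    have T: "set ys = A" "distinct ys" "length ys = k" "set zs = {1..n} - A" "distinct zs"
        "A \<subseteq> {1..n}" "list_peaks ys = S" "list_peaks zs = {}"
      if "(A, ys, zs) \<in> T" for A ys zs
      using that by (auto simp: T_def peak_lists_def permutations_of_set_def distinct_card)
    have "inj_on f T"
    proof (rule inj_onI)
      fix s t assume st: "s \<in> T" "t \<in> T" "f s = f t"
      obtain A ys zs B us vs where eq: "s = (A, ys, zs)" "t = (B, us, vs)"
        by (cases s, cases t) auto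
      note s = T[OF st(1)[unfolded eq]] and t = T[OF st(2)[unfolded eq]]
      have "ys = us \<and> zs = vs" using st(3) s(3) t(3) by (simp add: f_def eq)
      then show "s = t" using s(1) t(1) by (simp add: eq)
    qed
    moreover have "f ` T = X"
    proof (intro equalityI subsetI)
      fix xs assume "xs \<in> f ` T"
      then obtain A ys zs where *: "(A, ys, zs) \<in> T" "xs = ys @ zs" by (auto simp: f_def)
      then show "xs \<in> X"
        using T[OF *(1)] by (auto simp: X_def permutations_of_set_def)
    next
      fix xs assume xs: "xs \<in> X"
      then have d: "distinct xs" "set xs = {1..n}" by (auto simp: X_def permutations_of_set_def)
      then have len: "length xs = n" using distinct_card[of xs] by simp
      have "set (drop k xs) = {1..n} - set (take k xs)"
        using d set_take_disj_set_drop_if_distinct[of xs k k] append_take_drop_id[of k xs]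
        by (metis Diff_cancel Diff_triv Un_Diff Un_empty_left inf_commute order_refl set_append)
      moreover have "card (set (take k xs)) = k"
        using d len assms(2) by (simp add: distinct_card)
      moreover have "set (take k xs) \<subseteq> {1..n}" using d(2) set_take_subset by metis
      ultimately have "(set (take k xs), take k xs, drop k xs) \<in> T"
        using xs d(1) by (auto simp: T_def X_def peak_lists_def permutations_of_set_def)
      then show "xs \<in> f ` T" by (force simp: f_def)
    qed
    ultimately have "card X = card T" by (metis card_image)
    also have "card T = (\<Sum>A | A \<subseteq> {1..n} \<and> card A = k. card (peak_lists S A \<times> peak_lists {} ({1..n} - A)))"
      unfolding T_def
      by (rule card_SigmaI) (auto intro!: finite_cartesian_product finite_peak_lists intro: finite_subset)
    \<comment> \<open>By standardisation each summand depends on \<open>A\<close> only through its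
      size, so the sum has \<open>n choose k\<close> equal terms.\<close>
    also have "\<dots> = (\<Sum>A | A \<subseteq> {1..n} \<and> card A = k. peak_number S k * peak_number {} (n - k))"
    proof (intro sum.cong refl)
      fix A assume "A \<in> {A. A \<subseteq> {1..n} \<and> card A = k}"
      then have "finite A" "card A = k" "card ({1..n} - A) = n - k"
        by (auto simp: card_Diff_subset finite_subset)
      then show "card (peak_lists S A \<times> peak_lists {} ({1..n} - A)) = peak_number S k * peak_number {} (n - k)"
        by (simp add: card_cartesian_product card_peak_lists)
    qed
    also have "\<dots> = (n choose k) * peak_number S k * peak_number {} (n - k)"
      by (simp add: n_subsets)
    finally show ?thesis .
  qed
  ultimately show ?thesis by simp
qed

text \<open>In a word without peaks the largest letter stands at one of the two ends.\<close>

lemma peak_number_empty_Suc: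
  assumes "1 \<le> n"
  shows "peak_number {} (Suc n) = 2 * peak_number {} n"
proof -
  let ?P = "peak_lists {} {1..n}" and ?Q = "peak_lists {} {1..Suc n}"
  let ?L = "(#) (Suc n) ` ?P" and ?R = "(\<lambda>ys. ys @ [Suc n]) ` ?P"
  have "?Q = ?L \<union> ?R"
  proof (intro equalityI subsetI)
    fix xs assume xs: "xs \<in> ?Q"
    then have d: "distinct xs" "set xs = {1..Suc n}" and np: "list_peaks xs = {}"
      by (auto simp: peak_lists_def permutations_of_set_def)
    then have "Suc n \<in> set xs" by simp
    then obtain us vs where uv: "xs = us @ Suc n # vs" by (auto simp: in_set_conv_decomp)
    have "set (us @ vs) = {1..Suc n} - {Suc n}" using d(1) unfolding uv d(2)[symmetric] by auto
    also have "\<dots> = {1..n}" by auto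
    finally have set_uv: "set (us @ vs) = {1..n}" .
    \<comment> \<open>An interior largest letter exceeds both neighbours and would be a
      peak.\<close>
    have "us = [] \<or> vs = []"
    proof (rule ccontr)
      assume *: "\<not> (us = [] \<or> vs = [])"
      then have "xs ! (length us - 1) = last us" "xs ! Suc (length us) = hd vs"
        by (simp_all add: uv nth_append last_conv_nth hd_conv_nth)
      moreover have "last us \<in> {1..n}" "hd vs \<in> {1..n}"
        using * set_uv by auto
      ultimately have "Suc (length us) \<in> list_peaks xs"
        using * by (simp add: list_peaks_def uv numeral_2_eq_2)
      then show False using np by simp
    qed
    then show "xs \<in> ?L \<union> ?R"
    proof
      assume "us = []"
      then have "list_peaks vs = {}"
        using np list_peaks_drop[of 1 xs] by (simp add: uv)
      then have "vs \<in> ?P" using \<open>us = []\<close> d(1) set_uv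
        by (simp add: peak_lists_def permutations_of_set_def uv)
      then show ?thesis using \<open>us = []\<close> uv by simp
    next
      assume "vs = []"
      then have "list_peaks us = {}"
        using np list_peaks_take[of "length us" xs] by (simp add: uv)
      then have "us \<in> ?P" using \<open>vs = []\<close> d(1) set_uv
        by (simp add: peak_lists_def permutations_of_set_def uv)
      then show ?thesis using \<open>vs = []\<close> uv by simp
    qed
  next
    fix xs assume "xs \<in> ?L \<union> ?R"
    then consider ys where "ys \<in> ?P" "xs = Suc n # ys" | ys where "ys \<in> ?P" "xs = ys @ [Suc n]"
      by auto
    then show "xs \<in> ?Q"
    proof cases
      case (1 ys)
      then have ys: "distinct ys" "set ys = {1..n}" "list_peaks ys = {}"
        by (auto simp: peak_lists_def permutations_of_set_def)
      have "False" if i: "i \<in> list_peaks xs" for i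
      \<comment> \<open>Only position 2 gets a new left neighbour when \<open>Suc n\<close> is put
        in front; a peak there would need a letter above \<open>Suc n\<close>.\<close>
      proof (cases "i = 2")
        case True
        then have "Suc n < ys ! 0" "0 < length ys" using i 1 by (auto simp: list_peaks_def)
        then show False using ys(2) nth_mem[of 0 ys] by simp
      next
        case False
        then have "1 < i - 1" "1 + (i - 1) = i" using list_peaks_gt[OF i] by auto
        then have "i - 1 \<in> list_peaks (drop 1 xs)"
          using i by (simp add: list_peaks_drop)
        then show False using ys(3) 1 by simp
      qed
      then have "list_peaks xs = {}" by blast
      moreover have "set xs = {1..Suc n}" using ys(2) 1(2) by auto
      moreover have "distinct xs" using ys 1(2) by simp
      ultimately show ?thesis by (simp add: peak_lists_def permutations_of_set_def)
    next
      case (2 ys)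
      then have ys: "distinct ys" "set ys = {1..n}" "list_peaks ys = {}"
        by (auto simp: peak_lists_def permutations_of_set_def)
      have "False" if i: "i \<in> list_peaks xs" for i
      \<comment> \<open>Symmetrically, only the last position of \<open>ys\<close> gets a new right
        neighbour, which is too large for a peak.\<close>
      proof (cases "i = length ys")
        case True
        then have "i - 1 < length ys" using list_peaks_gt[OF i] by linarith
        moreover from this True have "Suc n < ys ! (i - 1)"
          using i 2 by (simp add: list_peaks_def nth_append)
        ultimately have "Suc n < ys ! (i - 1)" "i - 1 < length ys" by auto
        then show False using ys(2) nth_mem[of "i - 1" ys] by simp
      next
        case False
        then have "i < length ys" using list_peaks_gt[OF i] 2 by simp
        then have "i \<in> list_peaks (take (length ys) xs)"
          unfolding list_peaks_take using i by simp
        then show False using ys(3) 2 by simp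
      qed
      then have "list_peaks xs = {}" by blast
      moreover have "set xs = {1..Suc n}" using ys(2) 2(2) by auto
      moreover have "distinct xs" using ys 2(2) by simp
      ultimately show ?thesis by (simp add: peak_lists_def permutations_of_set_def)
    qed
  qed
  \<comment> \<open>For \<open>n = 0\<close> both images would be the single word
    \<open>[Suc n]\<close>; here \<open>1 <= n\<close> keeps them apart.\<close>
  moreover have "?L \<inter> ?R = {}"
  proof -
    have "Suc n # ys \<noteq> zs @ [Suc n]" if "zs \<in> ?P" for ys zs
    proof -
      have "set zs = {1..n}" using that by (simp add: peak_lists_def permutations_of_set_def)
      then have "zs \<noteq> []" "Suc n \<notin> set zs" using assms by auto
      then show ?thesis by (cases zs) auto
    qed
    then show ?thesis by blast
  qed
  moreover have "card ?L = card ?P" "card ?R = card ?P"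
    by (auto intro!: card_image simp: inj_on_def)
  ultimately show ?thesis
    by (simp add: peak_number_def card_Un_disjoint)
qed

lemma peak_number_empty:
  assumes "1 \<le> n"
  shows "peak_number {} n = 2 ^ (n - 1)"
  using assms
proof (induction n rule: dec_induct)
  case base
  have "list_peaks [Suc 0] = {}" by (auto simp: list_peaks_def)
  then have "peak_lists {} {1..1::nat} = {[1]}"
    by (auto simp: peak_lists_def)
  then show ?case by (simp add: peak_number_def)
next
  case (step n)
  then show ?case by (cases n) (auto simp: peak_number_empty_Suc)
qed

text \<open>Settles the degenerate cases: a peak at position 1, two adjacent peaks, a peak at the
  last position.\<close>

lemma peak_number_eq_0:
  assumes "\<And>xs. length xs = n \<Longrightarrow> list_peaks (xs :: nat list) \<noteq> S"
  shows "peak_number S n = 0"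
proof -
  have "peak_lists S {1..n} = {}"
  proof (rule equals0I)
    fix xs assume "xs \<in> peak_lists S {1..n}"
    then show False
      using assms[of xs] peak_lists_length[of xs S "{1..n}"] by (simp add: peak_lists_def)
  qed
  then show ?thesis by (simp add: peak_number_def)
qed

text \<open>Cutting at \<open>l\<close> with \<open>S = {}\<close> gives (n choose l) * 2^(n-2) =
  2^(n-1) + #P({l};n) + #P({l+1};n). Pascal's rule then carries the formula from \<open>l\<close> to
  \<open>l + 1\<close>, starting from the impossible peak at 1.\<close>

lemma peak_number_singleton:
  assumes "1 \<le> l" "l \<le> n"
  shows "real (peak_number {l} n) = (real ((n - 1) choose (l - 1)) - 1) * 2 ^ (n - 2)"
  using assms
proof (induction l rule: dec_induct)
  case base
  have "peak_number {1} n = 0"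
    by (rule peak_number_eq_0) (use list_peaks_gt in blast)
  then show ?case by simp
next
  case (step l)
  obtain l' where l': "l = Suc l'" using step.hyps by (cases l) auto
  obtain n' where n': "n = Suc (l + n')"
    using step.prems less_iff_Suc_add[of l n] by auto
  have "real ((n choose l) * peak_number {} l * peak_number {} (n - l))
    = real (peak_number {} n + peak_number {l} n + peak_number {Suc l} n)"
    using peak_number_split[of l n "{}"] step by simp
  moreover have "real (peak_number {l} n) = (real ((n - 1) choose (l - 1)) - 1) * 2 ^ (n - 2)"
    using step by simp
  ultimately show ?case
    by (simp add: peak_number_empty n' l' algebra_simps power_add)
qed

text \<open>Induction on \<open>m\<close> by cutting with \<open>S = {l}\<close>, starting from two
  adjacent peaks. Each step subtracts #P({l};n) and reverses the sign of everything earlier, so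
  these contributions cancel in pairs and one survives exactly when \<open>m - l\<close> is
  even.\<close>

lemma peak_number_doubleton:
  assumes "1 \<le> l" "Suc l \<le> m" "m \<le> n"
  shows "real (peak_number {l, m} n) =
    ((\<Sum>j<m - l - 1. (- 1) ^ j * (real ((m - j - 2) choose (l - 1)) - 1) * real (n choose (m - j - 1)))
      - 2 * (real ((n - 1) choose (l - 1)) - 1) * of_bool (even (m - l))) * 2 ^ (n - 3)"
  using assms(2,3)
proof (induction m rule: dec_induct)
  case base
  have "peak_number {l, Suc l} n = 0"
    by (rule peak_number_eq_0) (use list_peaks_not_consecutive in blast)
  then show ?case by simp
next
  case (step m)
  let ?a = "\<lambda>m j. real ((m - j - 2) choose (l - 1)) - 1"
  let ?Q = "\<lambda>m. (\<Sum>j<m - l - 1. (- 1) ^ j * ?a m j * real (n choose (m - j - 1)))"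
  let ?c = "real ((n - 1) choose (l - 1)) - 1"
  have IH: "real (peak_number {l, m} n) = (?Q m - 2 * ?c * of_bool (even (m - l))) * 2 ^ (n - 3)"
    using step by simp
  have "real ((n choose m) * peak_number {l} m * peak_number {} (n - m))
    = real (peak_number {l} n + peak_number {m, l} n + peak_number {Suc m, l} n)"
    using peak_number_split[of m n "{l}"] step by simp
  then have rec: "real (peak_number {l, Suc m} n) =
      real (n choose m) * real (peak_number {l} m) * real (peak_number {} (n - m))
      - real (peak_number {l} n) - real (peak_number {l, m} n)"
    by (simp add: insert_commute)
  \<comment> \<open>The term \<open>j = 0\<close> is the new product from the cut; the others are
    those of \<open>?Q m\<close> moved by one index, hence with opposite sign.\<close>
  have shift: "?Q (Suc m) = ?a (Suc m) 0 * real (n choose m) - ?Q m"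
  proof -
    have "Suc m - l - 1 = Suc (m - l - 1)" using step by simp
    then show ?thesis
      by (simp add: sum.lessThan_Suc_shift sum_negf del: sum.lessThan_Suc)
  qed
  have parity: "of_bool (even (Suc m - l)) = (1 - of_bool (even (m - l)) :: real)"
    using step by (simp add: Suc_diff_le)
  \<comment> \<open>The truncated exponents are exact, as \<open>2 <= m < n\<close> here.\<close>
  have pow: "2 ^ (m - 2) * 2 ^ (n - m - 1) = (2 :: real) ^ (n - 3)"
    "2 ^ (n - 2) = 2 * (2 :: real) ^ (n - 3)"
    using step assms(1) by (simp_all flip: power_add power_Suc)
  have "real (n choose m) * real (peak_number {l} m) * real (peak_number {} (n - m))
      = real (n choose m) * ?a (Suc m) 0 * (2 ^ (m - 2) * 2 ^ (n - m - 1))"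
    using step assms(1) by (simp add: peak_number_singleton peak_number_empty)
  moreover have "real (peak_number {l} n) = ?c * 2 ^ (n - 2)"
    using step assms(1) by (simp add: peak_number_singleton)
  ultimately show ?case
    unfolding rec IH shift parity pow by (simp add: algebra_simps)
qed

section \<open>Coefficients in the binomial basis\<close>

lemma gbinomial_shift_is_poly: "\<exists>p. \<forall>x::real. poly p x = (x - a) gchoose k"
proof
  show "\<forall>x. poly (smult (inverse (fact k)) (\<Prod>i<k. [:- a - real i, 1:])) x = (x - a) gchoose k"
    by (auto simp: poly_prod gbinomial_prod_rev field_simps atLeast0LessThan)
qed

text \<open>The system is triangular with unit diagonal: at \<open>n = k\<close> only the
  coefficients up to \<open>k\<close> occur.\<close>

lemma binomial_coeffs_unique:
  fixes C D :: "nat \<Rightarrow> real"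
  assumes "finite {k. C k \<noteq> 0}" "finite {k. D k \<noteq> 0}"
    and "\<And>n. (\<Sum>k | C k \<noteq> 0. C k * real (n choose k)) = (\<Sum>k | D k \<noteq> 0. D k * real (n choose k))"
  shows "C = D"
proof
  have trunc: "(\<Sum>k | C k \<noteq> 0. C k * real (n choose k)) = (\<Sum>k\<le>n. C k * real (n choose k))"
    if "finite {k. C k \<noteq> 0}" for C :: "nat \<Rightarrow> real" and n
    by (rule sum.mono_neutral_cong) (use that in \<open>auto simp: not_le\<close>)
  fix k show "C k = D k"
  proof (induction k rule: less_induct)
    case (less k)
    have "(\<Sum>i\<le>k. C i * real (k choose i)) = (\<Sum>i\<le>k. D i * real (k choose i))"
      using assms by (simp add: trunc)
    moreover have "(\<Sum>i<k. C i * real (k choose i)) = (\<Sum>i<k. D i * real (k choose i))"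
      using less by (intro sum.cong) auto
    ultimately show ?case by (simp add: lessThan_Suc_atMost[symmetric])
  qed
qed

text \<open>Discharges both definite descriptions: an explicit expansion of the counts supplies
  existence, and uniqueness holds for the polynomial and then for its coefficients.\<close>

lemma peak_coeff_eqI:
  fixes C :: "nat \<Rightarrow> real"
  assumes supp: "\<And>k. k > d \<Longrightarrow> C k = 0"
    and card: "\<And>n. n > max_pos S \<Longrightarrow> real (card (peak_perms S n))
      = (\<Sum>k\<le>d. C k * real ((n - max_pos S) choose k)) * 2 ^ (n - card S - 1)"
  shows "peak_coeff S = C"
proof -
  let ?m = "max_pos S"
  let ?is_pp = "\<lambda>p. \<forall>n > ?m. real (card (peak_perms S n)) = poly p (real n) * 2 ^ (n - card S - 1)"
  obtain q where q: "\<And>k x. poly (q k) x = (x - real ?m) gchoose k"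
    using gbinomial_shift_is_poly[of "real ?m"] by metis
  define p where "p = (\<Sum>k\<le>d. smult (C k) (q k))"
  have p: "poly p x = (\<Sum>k\<le>d. C k * ((x - real ?m) gchoose k))" for x
    by (simp add: p_def poly_sum q)
  have is_pp: "?is_pp p"
    by (auto simp: p card binomial_gbinomial of_nat_diff)
  have "peak_poly S = p"
    unfolding peak_poly_def
  proof (rule the_equality)
    fix r assume r: "?is_pp r"
    \<comment> \<open>Two candidate polynomials agree at every integer beyond the maximum, so their
      difference has infinitely many roots.\<close>
    have "real ` {?m<..} \<subseteq> {x. poly (r - p) x = 0}"
      using r is_pp by auto
    moreover have "infinite (real ` {?m<..})"
      by (simp add: finite_image_iff infinite_Ioi)
    ultimately have "r - p = 0"
      using poly_roots_finite finite_subset by blast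
    then show "r = p" by simp
  qed (fact is_pp)
  moreover have fin: "finite {k. C k \<noteq> 0}"
    by (rule finite_subset[of _ "{..d}"]) (use supp in \<open>auto simp: not_less[symmetric]\<close>)
  moreover have "poly p x = (\<Sum>k | C k \<noteq> 0. C k * ((x - real ?m) gchoose k))" for x
    unfolding p by (rule sum.mono_neutral_cong) (use fin supp in \<open>auto simp: not_less[symmetric]\<close>)
  ultimately show ?thesis
    unfolding peak_coeff_def
  proof (intro the_equality)
    fix D :: "nat \<Rightarrow> real"
    assume D: "finite {k. D k \<noteq> 0} \<and> (\<forall>x. poly (peak_poly S) x = (\<Sum>k | D k \<noteq> 0. D k * ((x - real ?m) gchoose k)))"
    assume C: "peak_poly S = p" "\<And>x. poly p x = (\<Sum>k | C k \<noteq> 0. C k * ((x - real ?m) gchoose k))"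
    show "D = C"
    proof (rule binomial_coeffs_unique)
      fix n
      show "(\<Sum>k | D k \<noteq> 0. D k * real (n choose k)) = (\<Sum>k | C k \<noteq> 0. C k * real (n choose k))"
        \<comment> \<open>Evaluating at \<open>max_pos S + n\<close> turns the shifted basis into
          ordinary binomials \<open>n choose k\<close>.\<close>
        using D C(1) C(2)[of "real ?m + real n"] by (simp add: binomial_gbinomial)
    qed (use D fin in auto)
  qed auto
qed

text \<open>Vandermonde followed by symmetry of the second factor. Terms with
  \<open>k > a - r\<close> vanish, so different values of \<open>a\<close> and \<open>r\<close> can
  share the range up to \<open>d\<close>.\<close>

lemma choose_add_expand:
  assumes "r \<le> a" "a \<le> d"
  shows "real ((a + n) choose (a - r)) = (\<Sum>k\<le>d. real (n choose k) * real (a choose (k + r)))"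
proof -
  have "(n + a) choose (a - r) = (\<Sum>k\<le>a - r. (n choose k) * (a choose (a - r - k)))"
    by (rule vandermonde[symmetric])
  also have "\<dots> = (\<Sum>k\<le>d. (n choose k) * (a choose (k + r)))"
  proof (rule sum.mono_neutral_cong)
    fix k assume "k \<in> {..a - r} \<inter> {..d}"
    then have "a - r - k = a - (k + r)" "k + r \<le> a" using assms by auto
    then show "(n choose k) * (a choose (a - r - k)) = (n choose k) * (a choose (k + r))"
      by (metis binomial_symmetric)
  qed (use assms in auto)
  finally show ?thesis by (simp add: add.commute)
qed

section \<open>Nonnegativity\<close>

text \<open>The hypothesis says that the step starts no earlier than just left of the middle of row
  \<open>n\<close>.\<close>

lemma choose_antimono_step:
  assumes "n \<le> 2 * i + 1"
  shows "n choose Suc i \<le> n choose i"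
proof (cases "Suc i \<le> n")
  case True
  then show ?thesis using assms binomial_antimono[of i "Suc i" n] by linarith
qed (simp add: not_le binomial_eq_0)

text \<open>Pair the terms \<open>2i\<close> and \<open>2i + 1\<close>; with an even number of terms
  none is left over.\<close>

lemma alternating_sum_nonneg:
  fixes f :: "nat \<Rightarrow> real"
  assumes "\<And>j. Suc j < 2 * r \<Longrightarrow> f (Suc j) \<le> f j"
  shows "0 \<le> (\<Sum>j<2 * r. (- 1) ^ j * f j)"
  using assms
proof (induction r)
  case (Suc r)
  then have "0 \<le> (\<Sum>j<2 * r. (- 1) ^ j * f j)" "f (Suc (2 * r)) \<le> f (2 * r)" by auto
  then show ?case by simp
qed simp

text \<open>The claimed closed form, taken at every \<open>k\<close>. At \<open>k = 0\<close> it is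
  not the coefficient: for admissible pairs its value there is -2 when \<open>m - l\<close> is
  even.\<close>

definition two_peak_coeff :: "nat \<Rightarrow> nat \<Rightarrow> nat \<Rightarrow> real" where
  "two_peak_coeff l m k = - 2 * real ((m - 1) choose (k + m - l)) * of_bool (even (m - l))
    + (\<Sum>j = 0..m - l - 2.
         (- 1) ^ j * (real ((m - j - 2) choose (l - 1)) - 1) * real (m choose (k + j + 1)))"

lemma two_peak_coeff_nonneg:
  assumes "2 \<le> l" "l + 2 \<le> m" "m \<le> 2 * k + 2"
  shows "0 \<le> two_peak_coeff l m k"
proof -
  define f where "f j = (real ((m - j - 2) choose (l - 1)) - 1) * real (m choose (k + j + 1))" for j
  have a_pos: "1 \<le> (m - j - 2) choose (l - 1)" if "j \<le> m - l - 2" for j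
  proof -
    have "l - 1 \<le> m - j - 2" using that assms by linarith
    then show ?thesis by (simp add: Suc_le_eq)
  qed
  \<comment> \<open>Both factors decrease in \<open>j\<close>: the upper index of the first drops,
    and \<open>m <= 2k + 2\<close> puts the second past the middle of row \<open>m\<close>.
    Positivity of the first binomial makes the product decrease too.\<close>
  have dec: "f (Suc j) \<le> f j" if "Suc j \<le> m - l - 2" for j
  proof -
    have "(m - Suc j - 2) choose (l - 1) \<le> (m - j - 2) choose (l - 1)"
      by (rule binomial_right_mono) simp
    moreover have "m choose (k + Suc j + 1) \<le> m choose (k + j + 1)"
      using choose_antimono_step[of m "k + j + 1"] assms by simp
    ultimately show ?thesis
      unfolding f_def using a_pos[OF that] a_pos[of j] that
      by (intro mult_mono) auto
  qed
  have eq: "two_peak_coeff l m k = - 2 * real ((m - 1) choose (k + m - l)) * of_bool (even (m - l))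
      + (\<Sum>j<m - l - 1. (- 1) ^ j * f j)"
  proof -
    have "{0..m - l - 2} = {..<m - l - 1}" using assms by auto
    then show ?thesis by (simp add: two_peak_coeff_def f_def mult.assoc)
  qed
  show ?thesis
  proof (cases "even (m - l)")
    case False
    then obtain r where r: "m - l = Suc (2 * r)" by (metis oddE Suc_eq_plus1)
    then have "0 \<le> (\<Sum>j<2 * r. (- 1) ^ j * f j)"
      by (intro alternating_sum_nonneg dec) auto
    then show ?thesis using r by (simp add: eq)
  next
    case True
    then obtain r' where r': "m - l = 2 * r'" by (rule evenE)
    with assms obtain r where r: "m - l = 2 * r + 2" by (cases r') auto
    have "0 \<le> (\<Sum>j<2 * r. (- 1) ^ j * f j)"
      using r by (intro alternating_sum_nonneg dec) auto
    \<comment> \<open>With \<open>i = k + 2r\<close> the unpaired last term is (l-1) * (m choose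
      (i+1)). Pascal splits this binomial into two entries of row \<open>m - 1\<close>, each at
      least the entry at \<open>i + 2 = k + m - l\<close>.\<close>
    moreover have "2 * real ((m - 1) choose (k + m - l)) \<le> f (2 * r)"
    proof -
      define i where "i = k + 2 * r"
      have m: "m = Suc (m - 1)" and i: "k + m - l = Suc (Suc i)" "m - 2 * r - 2 = l"
        using assms r by (auto simp: i_def)
      have "(m - 1) choose Suc (Suc i) \<le> (m - 1) choose Suc i"
        "(m - 1) choose Suc i \<le> (m - 1) choose i"
        using assms by (auto intro!: choose_antimono_step simp: i_def)
      moreover have "m choose Suc i = ((m - 1) choose i) + ((m - 1) choose Suc i)"
        by (subst m) simp
      ultimately have "2 * ((m - 1) choose (k + m - l)) \<le> m choose Suc i"
        unfolding i by linarith
      then have "2 * real ((m - 1) choose (k + m - l)) \<le> real (m choose Suc i)"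
        by linarith
      also have "\<dots> \<le> (real l - 1) * real (m choose Suc i)"
        using assms(1) mult_right_mono[of 1 "real l - 1" "real (m choose Suc i)"] by simp
      also have "l choose (l - 1) = l"
        using assms(1) binomial_symmetric[of 1 l] by simp
      then have "(real l - 1) * real (m choose Suc i) = f (2 * r)"
        unfolding f_def i(2) by (simp add: i_def)
      finally show ?thesis .
    qed
    ultimately show ?thesis using r by (simp add: eq)
  qed
qed

section \<open>Two peaks\<close>

text \<open>Both kinds of binomial in the count are expanded over the common range
  \<open>k <= m\<close>. The leftover constant 2, present for even \<open>m - l\<close>, is the
  extra coefficient at \<open>k = 0\<close>.\<close>

lemma peak_number_doubleton_expand:
  assumes "1 \<le> l" "l + 2 \<le> m"
  shows "real (peak_number {l, m} (m + n)) =
    (\<Sum>k\<le>m. (two_peak_coeff l m k + 2 * of_bool (even (m - l) \<and> k = 0)) * real (n choose k))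
      * 2 ^ (m + n - 3)"
proof -
  let ?e = "of_bool (even (m - l)) :: real"
  let ?a = "\<lambda>j. (- 1) ^ j * (real ((m - j - 2) choose (l - 1)) - 1)"
  have set_eq: "{0..m - l - 2} = {..<m - l - 1}" using assms by auto
  have "real ((m + n) choose (m - j - 1)) = (\<Sum>k\<le>m. real (n choose k) * real (m choose (k + j + 1)))"
    if "j < m - l - 1" for j
    using choose_add_expand[of "j + 1" m m n] that by simp
  then have "(\<Sum>j<m - l - 1. ?a j * real ((m + n) choose (m - j - 1)))
    = (\<Sum>j<m - l - 1. \<Sum>k\<le>m. ?a j * real (m choose (k + j + 1)) * real (n choose k))"
    by (intro sum.cong) (simp_all add: sum_distrib_left mult_ac)
  also have "\<dots> = (\<Sum>k\<le>m. (\<Sum>j<m - l - 1. ?a j * real (m choose (k + j + 1))) * real (n choose k))"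
    by (subst sum.swap) (simp add: sum_distrib_right)
  finally have 1: "(\<Sum>j<m - l - 1. ?a j * real ((m + n) choose (m - j - 1))) = \<dots>" .
  \<comment> \<open>Here \<open>m + n - 1 = (m - 1) + n\<close> and
    \<open>l - 1 = (m - 1) - (m - l)\<close>.\<close>
  have 2: "real ((m + n - 1) choose (l - 1)) = (\<Sum>k\<le>m. real ((m - 1) choose (k + m - l)) * real (n choose k))"
    using choose_add_expand[of "m - l" "m - 1" m n] assms by (simp add: mult.commute)
  have 3: "1 = (\<Sum>k\<le>m. of_bool (k = 0) * real (n choose k))"
    by (simp add: sum.atMost_shift)
  have "real (peak_number {l, m} (m + n)) =
    ((\<Sum>j<m - l - 1. ?a j * real ((m + n) choose (m - j - 1)))
      - 2 * (real ((m + n - 1) choose (l - 1)) - 1) * ?e) * 2 ^ (m + n - 3)"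
    using assms by (intro peak_number_doubleton) auto
  also have "(\<Sum>j<m - l - 1. ?a j * real ((m + n) choose (m - j - 1)))
      - 2 * (real ((m + n - 1) choose (l - 1)) - 1) * ?e
    = (\<Sum>k\<le>m. (\<Sum>j<m - l - 1. ?a j * real (m choose (k + j + 1))) * real (n choose k))
      - 2 * ((\<Sum>k\<le>m. real ((m - 1) choose (k + m - l)) * real (n choose k))
        - (\<Sum>k\<le>m. of_bool (k = 0) * real (n choose k))) * ?e"
    unfolding 1 2 by (subst 3) simp
  also have "\<dots> = (\<Sum>k\<le>m. (two_peak_coeff l m k + 2 * of_bool (even (m - l) \<and> k = 0)) * real (n choose k))"
  proof -
    have "(two_peak_coeff l m k + 2 * of_bool (even (m - l) \<and> k = 0)) * real (n choose k)
      = (\<Sum>j<m - l - 1. ?a j * real (m choose (k + j + 1))) * real (n choose k)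
        - 2 * ?e * (real ((m - 1) choose (k + m - l)) * real (n choose k)
          - of_bool (k = 0) * real (n choose k))" for k
      unfolding two_peak_coeff_def set_eq by (cases "even (m - l)") (simp_all add: algebra_simps)
    then show ?thesis
      by (simp only: sum_subtractf sum_distrib_left[symmetric]) (simp add: mult_ac)
  qed
  finally show ?thesis .
qed

lemma peak_coeff_doubleton:
  assumes "2 \<le> l" "l + 2 \<le> m"
  shows "peak_coeff {l, m} k = (if k = 0 then 0 else two_peak_coeff l m k)"
proof -
  \<comment> \<open>The coefficients as read off from the expansion; the correction affects only
    \<open>k = 0\<close>, where it must make the value 0.\<close>
  define D where "D k = two_peak_coeff l m k + 2 * of_bool (even (m - l) \<and> k = 0)" for k
  have expand: "real (peak_number {l, m} (m + n)) = (\<Sum>k\<le>m. D k * real (n choose k)) * 2 ^ (m + n - 3)" for n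
    unfolding D_def using assms by (intro peak_number_doubleton_expand) auto
  have "peak_number {l, m} m = 0"
    by (rule peak_number_eq_0) (use list_peaks_gt in blast)
  \<comment> \<open>The expansion is valid already at \<open>n = m\<close>, where position \<open>m\<close> is last and cannot be a peak.\<close>
  then have D0: "D 0 = 0"
    using expand[of 0] by (simp add: sum.atMost_shift)
  have "peak_coeff {l, m} = D"
  proof (rule peak_coeff_eqI[where d = m])
    fix k assume "k > m"
    then have "m - 1 < k + m - l" "m < k + j + 1" "k \<noteq> 0" for j
      using assms by auto
    then show "D k = 0" by (simp add: D_def two_peak_coeff_def binomial_eq_0)
  next
    have mp: "max_pos {l, m} = m" "card {l, m} = 2" using assms by (auto simp: max_pos_def)
    fix n assume "n > max_pos {l, m}"
    then show "real (card (peak_perms {l, m} n))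
      = (\<Sum>k\<le>m. D k * real ((n - max_pos {l, m}) choose k)) * 2 ^ (n - card {l, m} - 1)"
      using expand[of "n - m"] by (simp add: card_peak_perms mp)
  qed
  then show ?thesis using D0 by (simp add: D_def)
qed

theorem theorem5p5:
  fixes l m :: nat
  assumes "2 \<le> l" and "l < m" and "admissible {l, m}"
  shows "peak_coeff {l, m} 0 = 0
    \<and> (\<forall>k\<ge>1. peak_coeff {l, m} k =
          - 2 * real ((m - 1) choose (k + m - l)) * of_bool (even (m - l))
          + (\<Sum>j = 0..m - l - 2.
               (- 1) ^ j * (real ((m - j - 2) choose (l - 1)) - 1) * real (m choose (k + j + 1))))
    \<and> (\<forall>k. real k \<ge> (real m - 2) / 2 \<longrightarrow> peak_coeff {l, m} k \<ge> 0)"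
proof -
  have lm: "l + 2 \<le> m" using assms admissible_doubleton_iff by blast
  note coeff = peak_coeff_doubleton[OF assms(1) lm]
  have "0 \<le> peak_coeff {l, m} k" if "real k \<ge> (real m - 2) / 2" for k
  proof -
    have "m \<le> 2 * k + 2" using that by (simp add: field_simps)
    then show ?thesis using two_peak_coeff_nonneg[OF assms(1) lm] by (simp add: coeff)
  qed
  then show ?thesis by (auto simp: coeff two_peak_coeff_def)
qed

end
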